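(* Let $X$ be a finite skew brace of nilpotent type and let $L=L_\infty(X)$. If $$\gcd\bigl(|L|,\,[\mathfrak{R}_L(X):L]\bigr)=1,$$ then $L$ is an ideal of $X$ and $\mathfrak{R}_L(X)=L$.
   Context: A skew (left) brace is a triple $X=(X,+,\cdot)$ such that $(X,+)$ and $(X,\cdot)$ are groups on the same set and $a\cdot(b+c)=a\cdot b-a+a\cdot c$ for all $a,b,c\in X$. $X$ is of nilpotent type if $(X,+)$ is nilpotent. Put $\lambda_a(b)=-a+a\cdot b$ and $a*b=\lambda_a(b)-b$; for subsets $S,T$, $S*T$ is the subgroup of $(X,+)$ generated by all $s*t$, $s\in S$, $t\in T$. An ideal of $X$ is a subgroup of $(X,+)$ that is invariant under every $\lambda_a$ and normal in both $(X,+)$ and $(X,\cdot)$. The left series is $X^1=X$, $X^{n+1}=X*X^n$; $X$ is left nilpotent if $X^n=0$ for some $n$; $L_\infty(X)=\bigcap_{n\ge1}X^n$. The left-nilpotent residual $\mathfrak{R}_L(X)$ is the intersection of all ideals $I$ of $X$ such that $X/I$ is left nilpotent; it contains $L_\infty(X)$. *)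

theory Defs
  imports "HOL-Algebra.Algebra"
begin

fun lower_central_series :: "('a, 'b) monoid_scheme \<Rightarrow> nat \<Rightarrow> 'a set" where
  "lower_central_series G 0 = carrier G"
| "lower_central_series G (Suc n) =
     generate G (\<Union>x \<in> carrier G. \<Union>y \<in> lower_central_series G n.
       {x \<otimes>\<^bsub>G\<^esub> y \<otimes>\<^bsub>G\<^esub> inv\<^bsub>G\<^esub> x \<otimes>\<^bsub>G\<^esub> inv\<^bsub>G\<^esub> y})"

definition nilpotent_group :: "('a, 'b) monoid_scheme \<Rightarrow> bool" where
  "nilpotent_group G \<longleftrightarrow> group G \<and> (\<exists>n. lower_central_series G n = {\<one>\<^bsub>G\<^esub>})"

text \<open>
  Skew braces live on the ring records of HOL-Algebra, used only as a signature with two binary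
  operations: \<^term>\<open>add_monoid B\<close> is the additive group, which need not be commutative, and
  \<^term>\<open>B\<close> itself, read as a monoid record, is the multiplicative group. The
  compatibility axiom forces \<^term>\<open>\<one>\<^bsub>B\<^esub> = \<zero>\<^bsub>B\<^esub>\<close>.
\<close>

locale skew_brace =
  fixes B :: "('a, 'b) ring_scheme" (structure)
  assumes add_group: "group (add_monoid B)"
    and mult_group: "group B"
    and compat: "\<lbrakk>a \<in> carrier B; b \<in> carrier B; c \<in> carrier B\<rbrakk>
      \<Longrightarrow> a \<otimes> (b \<oplus> c) = (a \<otimes> b) \<ominus> a \<oplus> (a \<otimes> c)"

definition nilpotent_type :: "('a, 'b) ring_scheme \<Rightarrow> bool" where
  "nilpotent_type B \<longleftrightarrow> nilpotent_group (add_monoid B)"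

definition brace_lambda :: "('a, 'b) ring_scheme \<Rightarrow> 'a \<Rightarrow> 'a \<Rightarrow> 'a" where
  "brace_lambda B a b = \<ominus>\<^bsub>B\<^esub> a \<oplus>\<^bsub>B\<^esub> (a \<otimes>\<^bsub>B\<^esub> b)"

definition brace_star :: "('a, 'b) ring_scheme \<Rightarrow> 'a \<Rightarrow> 'a \<Rightarrow> 'a" where
  "brace_star B a b = brace_lambda B a b \<ominus>\<^bsub>B\<^esub> b"

definition set_star :: "('a, 'b) ring_scheme \<Rightarrow> 'a set \<Rightarrow> 'a set \<Rightarrow> 'a set" where
  "set_star B S T = generate (add_monoid B) (\<Union>s \<in> S. \<Union>t \<in> T. {brace_star B s t})"

definition brace_ideal :: "'a set \<Rightarrow> ('a, 'b) ring_scheme \<Rightarrow> bool" where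
  "brace_ideal I B \<longleftrightarrow>
     subgroup I (add_monoid B) \<and>
     (\<forall>a \<in> carrier B. brace_lambda B a ` I \<subseteq> I) \<and>
     I \<lhd> add_monoid B \<and> I \<lhd> B"

text \<open>
  The series is indexed from 1, so that \<^term>\<open>left_series B n\<close> is $B^n$ for $n \ge 1$;
  the value at 0 is junk (equal to the value at 1).
\<close>

definition left_series :: "('a, 'b) ring_scheme \<Rightarrow> nat \<Rightarrow> 'a set" where
  "left_series B n = (set_star B (carrier B) ^^ (n - 1)) (carrier B)"

definition left_nilpotent :: "('a, 'b) ring_scheme \<Rightarrow> bool" where
  "left_nilpotent B \<longleftrightarrow> (\<exists>n\<ge>1. left_series B n = {\<zero>\<^bsub>B\<^esub>})"

definition L_infinity :: "('a, 'b) ring_scheme \<Rightarrow> 'a set" where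
  "L_infinity B = (\<Inter>n\<in>{1..}. left_series B n)"

text \<open>
  The quotient skew brace is \<^term>\<open>B Quot I\<close>: its elements are the additive cosets of
  \<^term>\<open>I\<close>, which for an ideal are also the multiplicative cosets, and its operations are
  the induced ones (see the coset lemmas below).
\<close>

definition left_nilpotent_residual :: "('a, 'b) ring_scheme \<Rightarrow> 'a set" where
  "left_nilpotent_residual B = \<Inter>{I. brace_ideal I B \<and> left_nilpotent (B Quot I)}"

definition subgroup_index :: "('a, 'b) monoid_scheme \<Rightarrow> 'a set \<Rightarrow> 'a set \<Rightarrow> nat" where
  "subgroup_index G K H = card (rcosets\<^bsub>G\<lparr>carrier := K\<rparr>\<^esub> H)"

lemma (in skew_brace) brace_ideal_cosets:
  assumes I: "brace_ideal I B" and a: "a \<in> carrier B"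
  shows "I +> a = I #> a"
proof -
  interpret A: group "add_monoid B" by (rule add_group)
  interpret M: group B by (rule mult_group)
  interpret NA: normal I "add_monoid B" using I by (simp add: brace_ideal_def)
  interpret NM: normal I B using I by (simp add: brace_ideal_def)
  have lam: "brace_lambda B b i \<in> I" if "b \<in> carrier B" "i \<in> I" for b i
    using I that by (auto simp: brace_ideal_def)
  have IX: "i \<in> carrier B" if "i \<in> I" for i
    using NM.mem_carrier that by simp
  have mem: "i \<in> I" if "i \<in> carrier B" "brace_lambda B a i \<in> I" for i
  proof -
    let ?j = "brace_lambda B a i" and ?c = "inv a"
    have c: "?c \<in> carrier B" using a by simp
    have na: "\<ominus> a \<in> carrier B" using A.inv_closed a by (simp add: a_inv_def)
    have ai: "a \<otimes> i \<in> carrier B" using a that by simp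
    have e: "a \<otimes> i = a \<oplus> ?j"
      using A.m_assoc[of a "\<ominus> a" "a \<otimes> i"] A.r_inv[of a] A.l_one[of "a \<otimes> i"] a na ai
      by (simp add: brace_lambda_def a_inv_def)
    have jX: "?j \<in> carrier B" using that IX by blast
    have "i = ?c \<otimes> (a \<otimes> i)" using a that c by (simp add: M.m_assoc[symmetric])
    also have "\<dots> = ?c \<otimes> (a \<oplus> ?j)" using e by simp
    also have "\<dots> = (?c \<otimes> a) \<ominus> ?c \<oplus> (?c \<otimes> ?j)" by (rule compat) (use a c jX in auto)
    also have "\<dots> = \<one> \<oplus> (\<ominus> ?c) \<oplus> (?c \<otimes> ?j)" using a by (simp add: a_minus_def)
    also have "\<one> = \<zero>"
    proof -
      have "\<one> \<otimes> (\<one> \<oplus> \<one>) = (\<one> \<otimes> \<one>) \<ominus> \<one> \<oplus> (\<one> \<otimes> \<one>)" by (rule compat) auto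
      then have "\<one> \<oplus> \<one> = \<one>"
        using A.r_inv[of \<one>] A.l_one[of \<one>] A.m_closed[of \<one> \<one>]
        by (simp add: a_minus_def a_inv_def)
      then show ?thesis using A.r_cancel_one[of \<one> \<one>] by simp
    qed
    also have "\<zero> \<oplus> (\<ominus> ?c) \<oplus> (?c \<otimes> ?j) = brace_lambda B ?c ?j"
      using A.l_one[of "\<ominus> ?c"] A.inv_closed[of ?c] c by (simp add: brace_lambda_def a_inv_def)
    finally show ?thesis using lam[OF c that(2)] by simp
  qed
  have "l_coset B a I = a <+ I"
  proof (intro equalityI subsetI)
    fix x assume "x \<in> l_coset B a I"
    then obtain i where i: "i \<in> I" "x = a \<otimes> i" by (auto simp: l_coset_def)
    have "x = a \<oplus> brace_lambda B a i"
      using A.m_assoc[of a "\<ominus> a" "a \<otimes> i"] A.r_inv[of a] A.l_one[of "a \<otimes> i"]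
        A.inv_closed[of a] a IX[OF i(1)] i(2)
      by (simp add: brace_lambda_def a_inv_def)
    then show "x \<in> a <+ I" using lam[OF a i(1)] by (auto simp: a_l_coset_def l_coset_def)
  next
    fix x assume "x \<in> a <+ I"
    then obtain j where j: "j \<in> I" "x = a \<oplus> j" by (auto simp: a_l_coset_def l_coset_def)
    have xX: "x \<in> carrier B" using A.m_closed[of a j] a IX[OF j(1)] j(2) by simp
    define i where "i = inv a \<otimes> x"
    have iX: "i \<in> carrier B" and ai: "a \<otimes> i = x"
      using a xX by (simp_all add: i_def M.m_assoc[symmetric])
    have "brace_lambda B a i = j"
      using A.m_assoc[of "\<ominus> a" a j] A.l_inv[of a] A.l_one[of j] A.inv_closed[of a] a
        IX[OF j(1)] j(2) ai
      by (simp add: brace_lambda_def a_inv_def)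
    then have "i \<in> I" using mem[OF iX] j(1) by simp
    then show "x \<in> l_coset B a I" using ai by (auto simp: l_coset_def)
  qed
  moreover have "I +> a = a <+ I" "I #> a = l_coset B a I"
    using NA.coset_eq NM.coset_eq a by (simp_all add: a_r_coset_def a_l_coset_def)
  ultimately show ?thesis by simp
qed

lemma (in skew_brace) brace_Quot_ops:
  assumes I: "brace_ideal I B" and ab: "a \<in> carrier B" "b \<in> carrier B"
  shows "(I +> a) \<otimes>\<^bsub>B Quot I\<^esub> (I +> b) = I +> (a \<otimes> b)"
    and "(I +> a) \<oplus>\<^bsub>B Quot I\<^esub> (I +> b) = I +> (a \<oplus> b)"
proof -
  interpret A: group "add_monoid B" by (rule add_group)
  interpret M: group B by (rule mult_group)
  interpret NA: normal I "add_monoid B" using I by (simp add: brace_ideal_def)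
  interpret NM: normal I B using I by (simp add: brace_ideal_def)
  note coset = brace_ideal_cosets[OF I]
  have "I +> (x \<otimes> y) = I +> (a \<otimes> b)" if "x \<in> I +> a" "y \<in> I +> b" for x y
  proof -
    have x: "x \<in> I #> a" and y: "y \<in> I #> b" using that coset ab by auto
    have xyB: "x \<in> carrier B" "y \<in> carrier B"
      using x y ab M.r_coset_subset_G[OF NM.subset] by blast+
    have "I #> (x \<otimes> y) = (I #> x) <#> (I #> y)" using NM.rcos_sum xyB by simp
    also have "\<dots> = (I #> a) <#> (I #> b)"
      using M.repr_independence[OF x ab(1) NM.subgroup_axioms]
        M.repr_independence[OF y ab(2) NM.subgroup_axioms] by simp
    also have "\<dots> = I #> (a \<otimes> b)" using NM.rcos_sum ab by simp
    finally show ?thesis using coset xyB ab by simp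
  qed
  moreover have "a \<in> I +> a" "b \<in> I +> b"
    using A.rcos_self[OF _ NA.subgroup_axioms] ab by (auto simp: a_r_coset_def)
  ultimately show "(I +> a) \<otimes>\<^bsub>B Quot I\<^esub> (I +> b) = I +> (a \<otimes> b)"
    unfolding FactRing_def rcoset_mult_def monoid.simps by blast
  show "(I +> a) \<oplus>\<^bsub>B Quot I\<^esub> (I +> b) = I +> (a \<oplus> b)"
    using NA.rcos_sum[of a b] ab unfolding FactRing_def set_add_def a_r_coset_def by simp
qed

end

theory Submission
  imports Defs
begin

text \<open>
  Write \<open>X\<close> for the skew brace, \<open>L\<close> for the limit of its left series and \<open>R\<close> for the
  left-nilpotent residual. A quotient of \<open>X\<close> by an ideal is left nilpotent exactly if the ideal
  contains a term of the left series (\<open>left_nilpotent_Quot_iff\<close>), and for finite \<open>X\<close> the limit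
  \<open>L\<close> is itself such a term. Hence \<open>R\<close> is the smallest ideal containing \<open>L\<close>, and everything
  comes down to showing that \<open>L\<close> is an ideal.

  The additive group is nilpotent, so it is the sum of two characteristic subgroups: \<open>H\<close>, the
  elements whose order involves only primes dividing the order of \<open>L\<close>, and \<open>K\<close>, the elements of
  order prime to that of \<open>L\<close> (\<open>nilpotent_power_one_subgroup\<close>). Being characteristic, both are
  invariant under the lambda action. The coprimality assumption makes \<open>L\<close> a Hall subgroup of
  \<open>R\<close>, that is, \<open>L = R \<inter> H\<close>, and so \<open>L\<close> is normal in the additive group.

  By \<open>brace_idealI\<close> it remains to see that
  \<open>l * x = lam l x \<ominus> x\<close> lies in \<open>L\<close> for \<open>l\<close> in \<open>L\<close> and
  arbitrary \<open>x\<close>. As \<open>L\<close> meets \<open>K\<close> trivially, the left series reaches zero on \<open>K\<close>, while the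
  multiplicative order of \<open>l\<close> is prime to the orders of the elements of \<open>K\<close>. A coprime action
  that is trivial on the steps of a series is trivial (\<open>coprime_action_trivial\<close>), so \<open>l\<close> fixes
  \<open>K\<close> pointwise. Writing \<open>x = a \<oplus> b\<close> with \<open>a\<close> in \<open>H\<close> and \<open>b\<close> in \<open>K\<close> gives
  \<open>l * x = l * a\<close>. This element lies in \<open>H\<close> because \<open>H\<close> is invariant, and in \<open>R\<close> because
  \<open>R\<close> is an ideal containing \<open>l\<close>; so it lies in \<open>R \<inter> H = L\<close>.
\<close>

section \<open>Arithmetic and powers in groups\<close>

lemma coprime_natI:
  fixes a b :: nat
  assumes "\<And>p. Factorial_Ring.prime p \<Longrightarrow> p dvd a \<Longrightarrow> \<not> p dvd b"
  shows "coprime a b"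
proof (rule ccontr)
  assume "\<not> coprime a b"
  then have "gcd a b \<noteq> 1" by (simp add: coprime_iff_gcd_eq_1)
  then obtain p where "Factorial_Ring.prime p" "p dvd gcd a b" using prime_factor_nat by blast
  then show False using assms by auto
qed

text \<open>
  The factor \<open>u\<close> is the part of \<open>N\<close> composed of the primes dividing \<open>m\<close>. It is the largest
  divisor of \<open>N\<close> with no other prime factors: a prime of \<open>m\<close> still dividing the cofactor \<open>v\<close>
  could be moved into \<open>u\<close>.
\<close>

lemma coprime_split_nat:
  fixes m N :: nat
  assumes "N > 0" "m dvd N"
  obtains u v where "N = u * v" "coprime u v" "m dvd u" "\<And>p. Factorial_Ring.prime p \<Longrightarrow> p dvd u \<Longrightarrow> p dvd m"
proof -
  let ?P = "\<lambda>u. u dvd N \<and> (\<forall>p. Factorial_Ring.prime p \<longrightarrow> p dvd u \<longrightarrow> p dvd m)"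
  have "\<forall>u. ?P u \<longrightarrow> u \<le> N" using assms(1) by (auto intro: dvd_imp_le)
  moreover have "?P m" using assms(2) by auto
  ultimately obtain u where u: "?P u" and max: "\<And>w. ?P w \<Longrightarrow> w \<le> u"
    using Nat.ex_has_greatest_nat[of ?P m N] by auto
  obtain v where v: "N = u * v" using u by auto
  have npv: "\<not> p dvd v" if "Factorial_Ring.prime p" "p dvd m" for p
  proof
    assume "p dvd v"
    then have "?P (u * p)" using u v that by (auto simp: prime_dvd_mult_iff primes_dvd_imp_eq)
    then show False using max[of "u * p"] prime_gt_1_nat[OF that(1)] v assms(1) by auto
  qed
  have "coprime w v" if "\<And>p. Factorial_Ring.prime p \<Longrightarrow> p dvd w \<Longrightarrow> p dvd m" for w
    using that npv by (blast intro: coprime_natI)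
  then have "coprime m v" and cuv: "coprime u v" using u by auto
  then show ?thesis using that[OF v cuv] u v assms(2) by (auto simp: coprime_dvd_mult_left_iff)
qed

declare lower_central_series.simps(2) [simp del]

context group
begin

lemma coprime_powers_in_subgroup:
  fixes m n :: nat
  assumes N: "subgroup N G" and x: "x \<in> carrier G" and mn: "coprime m n"
    and xm: "x [^] m \<in> N" and xn: "x [^] n \<in> N"
  shows "x \<in> N"
proof -
  obtain a b where ab: "a * int m + b * int n = 1"
    using mn bezout_int[of "int m" "int n"] by auto
  have "x = x [^] (a * int m + b * int n)" using x ab by simp
  also have "\<dots> = x [^] (int m * a) \<otimes> x [^] (int n * b)"
    using x by (simp add: int_pow_mult mult.commute)
  also have "\<dots> = (x [^] m) [^] a \<otimes> (x [^] n) [^] b"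
    using x by (simp add: int_pow_pow[symmetric] int_pow_int)
  also have "\<dots> \<in> N"
    using N xm xn by (intro subgroup.m_closed subgroup_int_pow_closed)
  finally show ?thesis .
qed

lemma coprime_power_decomposition:
  fixes u v :: nat
  assumes x: "x \<in> carrier G" and uv: "coprime u v" "x [^] (u * v) = \<one>"
  obtains a b :: int where "x = x [^] a \<otimes> x [^] b"
    "(x [^] a) [^] u = \<one>" "(x [^] b) [^] v = \<one>"
proof -
  obtain s t where st: "s * int u + t * int v = 1"
    using uv bezout_int[of "int u" "int v"] by auto
  have 1: "x [^] (int (u * v)) = \<one>" using uv(2) by (simp only: int_pow_int)
  have k: "x [^] (int (u * v) * j) = \<one>" for j
    using x 1 by (metis int_pow_pow int_pow_one)
  have "x = x [^] (t * int v + s * int u)" using x st by (simp add: add.commute)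
  then have "x = x [^] (t * int v) \<otimes> x [^] (s * int u)" using x by (simp add: int_pow_mult)
  moreover have "(x [^] (t * int v)) [^] u = \<one>" "(x [^] (s * int u)) [^] v = \<one>"
    using x k[of t] k[of s] 
    by (simp_all only: int_pow_int[symmetric] int_pow_pow of_nat_mult mult.assoc mult.commute mult.left_commute)
  ultimately show ?thesis using that by blast
qed

lemma inv_mult_cancel_left:
  assumes "x \<in> carrier G" "y \<in> carrier G"
  shows "inv x \<otimes> (x \<otimes> y) = y" "x \<otimes> (inv x \<otimes> y) = y"
  using assms by (simp_all flip: m_assoc)

lemma mult_commutator:
  assumes "x \<in> carrier G" "y \<in> carrier G"
  shows "x \<otimes> y = (x \<otimes> y \<otimes> inv x \<otimes> inv y) \<otimes> (y \<otimes> x)"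
  using assms by (simp add: m_assoc inv_mult_cancel_left)

text \<open>
  Everything known here about nilpotent groups comes from looking at powers of a product modulo
  one term of the lower central series at a time, where the factors commute.
\<close>

lemma nat_pow_mult_mod_normal:
  fixes n :: nat
  assumes "N \<lhd> G" and x: "x \<in> carrier G" and y: "y \<in> carrier G"
    and c: "x \<otimes> y \<otimes> inv x \<otimes> inv y \<in> N"
  shows "N #> (x \<otimes> y) [^] n = N #> (x [^] n \<otimes> y [^] n)"
proof -
  interpret N: normal N G by fact
  interpret Q: group "G Mod N" by (rule N.factorgroup_is_group)
  interpret h: group_hom G "G Mod N" "\<lambda>a. N #> a"
    by unfold_locales (rule N.r_coset_hom_Mod)
  have "x \<otimes> y = (x \<otimes> y \<otimes> inv x \<otimes> inv y) \<otimes> (y \<otimes> x)"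
    using x y by (rule mult_commutator)
  then have "N #> (x \<otimes> y) = N #> (y \<otimes> x)"
    using x y c by (metis coset_mult_assoc coset_join2 N.is_subgroup N.subset m_closed inv_closed)
  then have "(N #> x) \<otimes>\<^bsub>G Mod N\<^esub> (N #> y) = (N #> y) \<otimes>\<^bsub>G Mod N\<^esub> (N #> x)"
    using x y by (metis h.hom_mult)
  then show ?thesis
    using x y Q.pow_mult_distrib[of "N #> x" "N #> y" n] h.hom_closed
    by (simp only: h.hom_nat_pow h.hom_mult m_closed nat_pow_closed)
qed

lemma subgroup_pow_card:
  assumes H: "subgroup H G" and x: "x \<in> H"
  shows "x [^] card H = \<one>"
  using group.pow_order_eq_1[OF subgroup_imp_group[OF H], of x] x
  by (simp add: order_def flip: nat_pow_consistent)

text \<open>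
  Cauchy's theorem: a Sylow argument yields a subgroup of order \<open>p\<close>, and a nontrivial element of
  it would otherwise have both \<open>p\<close> and the coprime number \<open>u\<close> as exponents.
\<close>

lemma prime_dvd_card_imp_dvd_exponent:
  assumes H: "subgroup H G" and fin: "finite H" and exp: "\<And>x. x \<in> H \<Longrightarrow> x [^] u = \<one>"
    and p: "Factorial_Ring.prime p" "p dvd card H"
  shows "p dvd u"
proof (rule ccontr)
  assume np: "\<not> p dvd u"
  interpret H: group "G\<lparr>carrier := H\<rparr>" by (rule subgroup_imp_group[OF H])
  obtain k where "order (G\<lparr>carrier := H\<rparr>) = p ^ 1 * k" using p(2) by (auto simp: order_def)
  then obtain P where P: "subgroup P (G\<lparr>carrier := H\<rparr>)" "card P = p"
    using sylow_thm[OF p(1) H.group_axioms, of 1 k] fin by auto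
  have PG: "subgroup P G" using incl_subgroup[OF H P(1)] .
  have PH: "P \<subseteq> H" using subgroup.subset[OF P(1)] by simp
  have "P \<noteq> {\<one>}" using P(2) p(1) by auto
  then obtain x where x: "x \<in> P" "x \<noteq> \<one>" using subgroup.one_closed[OF PG] by blast
  have "coprime p u" using p(1) np by (simp add: prime_imp_coprime)
  then have "x \<in> {\<one>}"
    using coprime_powers_in_subgroup[OF triv_subgroup subgroup.mem_carrier[OF PG x(1)]]
      subgroup_pow_card[OF PG x(1)] exp[of x] x(1) PH P(2) by auto
  then show False using x(2) by simp
qed

lemma lagrange_subgroup:
  assumes H: "subgroup H G" and K: "subgroup K G" and HK: "H \<subseteq> K"
  shows "subgroup_index G K H * card H = card K"
  using group.lagrange[OF subgroup_imp_group[OF K] subgroup_incl[OF H K HK]]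
  by (simp add: subgroup_index_def order_def)

lemma pow_mult_mod_normal_iff:
  fixes n :: nat
  assumes N: "N \<lhd> G" and x: "x \<in> carrier G" and y: "y \<in> carrier G"
    and c: "x \<otimes> y \<otimes> inv x \<otimes> inv y \<in> N" and yn: "y [^] n \<in> N"
  shows "(x \<otimes> y) [^] n \<in> N \<longleftrightarrow> x [^] n \<in> N"
proof -
  interpret N: normal N G by fact
  have iff: "z \<in> N \<longleftrightarrow> N #> z = N" if "z \<in> carrier G" for z
    using that coset_join1 coset_join2 N.is_subgroup by blast
  have "x [^] n \<otimes> y [^] n \<in> N \<longleftrightarrow> x [^] n \<in> N"
    using x y yn N.m_closed N.m_inv_closed
    by (metis N.mem_carrier inv_closed m_assoc nat_pow_closed r_inv r_one)
  then show ?thesis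
    using nat_pow_mult_mod_normal[OF N x y c, of n] iff x y by (metis m_closed nat_pow_closed)
qed

lemma conj_nat_pow:
  assumes "g \<in> carrier G" "x \<in> carrier G"
  shows "(g \<otimes> x \<otimes> inv g) [^] (n::nat) = g \<otimes> x [^] n \<otimes> inv g"
proof (induction n)
  case (Suc n)
  have "g \<otimes> x [^] n \<otimes> inv g \<otimes> (g \<otimes> x \<otimes> inv g) = g \<otimes> x [^] n \<otimes> (inv g \<otimes> g) \<otimes> x \<otimes> inv g"
    using assms by (simp only: m_assoc m_closed nat_pow_closed inv_closed)
  then show ?case using Suc assms by (simp add: m_assoc)
qed (use assms in simp)

section \<open>Nilpotent groups and their Hall subgroups\<close>

lemma lower_central_series_normal: "lower_central_series G n \<lhd> G"
proof (induction n)
  case 0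
  show ?case by (simp add: normal_invI subgroup_self)
next
  case (Suc n)
  interpret N: normal "lower_central_series G n" G by fact
  show ?case unfolding lower_central_series.simps
  proof (rule normal_generateI)
    show "(\<Union>x \<in> carrier G. \<Union>y \<in> lower_central_series G n. {x \<otimes> y \<otimes> inv x \<otimes> inv y}) \<subseteq> carrier G"
      by (auto dest: N.mem_carrier)
  next
    fix h g assume "h \<in> (\<Union>x \<in> carrier G. \<Union>y \<in> lower_central_series G n. {x \<otimes> y \<otimes> inv x \<otimes> inv y})"
      and g: "g \<in> carrier G"
    then obtain x y where h: "h = x \<otimes> y \<otimes> inv x \<otimes> inv y"
      and x: "x \<in> carrier G" and yN: "y \<in> lower_central_series G n" by auto
    have y: "y \<in> carrier G" using yN by (rule N.mem_carrier)
    let ?c = "\<lambda>z. g \<otimes> z \<otimes> inv g"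
    have mult: "?c (a \<otimes> b) = ?c a \<otimes> ?c b" if "a \<in> carrier G" "b \<in> carrier G" for a b
    proof -
      have "inv g \<otimes> (g \<otimes> (b \<otimes> inv g)) = b \<otimes> inv g" using g that by (simp flip: m_assoc)
      then show ?thesis using g that by (simp add: m_assoc)
    qed
    have inv: "?c (inv a) = inv (?c a)" if "a \<in> carrier G" for a
      using g that by (simp add: inv_mult_group m_assoc)
    have "?c h = ?c x \<otimes> ?c y \<otimes> inv (?c x) \<otimes> inv (?c y)"
      using x y g by (simp add: h mult inv)
    moreover have "?c x \<in> carrier G" "?c y \<in> lower_central_series G n"
      using x g yN by (auto intro: N.inv_op_closed2)
    ultimately show "?c h \<in> (\<Union>x \<in> carrier G. \<Union>y \<in> lower_central_series G n. {x \<otimes> y \<otimes> inv x \<otimes> inv y})"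
      by blast
  qed
qed

lemma commutator_in_lower_central_series:
  assumes "x \<in> carrier G" "y \<in> lower_central_series G n"
  shows "x \<otimes> y \<otimes> inv x \<otimes> inv y \<in> lower_central_series G (Suc n)"
  using assms by (auto simp: lower_central_series.simps(2) intro!: generate.incl)

lemma commutator_in_lower_central_series':
  assumes y: "y \<in> carrier G" and x: "x \<in> lower_central_series G n"
  shows "x \<otimes> y \<otimes> inv x \<otimes> inv y \<in> lower_central_series G (Suc n)"
proof -
  interpret N: normal "lower_central_series G n" G by (rule lower_central_series_normal)
  interpret M: normal "lower_central_series G (Suc n)" G by (rule lower_central_series_normal)
  have xG: "x \<in> carrier G" using x by (rule N.mem_carrier)
  have "inv (y \<otimes> x \<otimes> inv y \<otimes> inv x) = x \<otimes> y \<otimes> inv x \<otimes> inv y"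
    using xG y by (simp add: inv_mult_group m_assoc)
  then show ?thesis using M.m_inv_closed[OF commutator_in_lower_central_series[OF y x]] by simp
qed

text \<open>
  Write \<open>z\<close> for the commutator of \<open>x\<close> and \<open>y\<close>. If \<open>z\<close> lies in a term of the lower central
  series, then it is central modulo the next term. Since \<open>z \<otimes> y\<close> is a conjugate of \<open>y\<close>, taking
  \<open>n\<close>-th powers puts \<open>z [^] n\<close> into that next term; symmetrically, \<open>x\<close> is \<open>z\<close> times a
  conjugate of \<open>x\<close>, which puts \<open>z [^] m\<close> there. As \<open>m\<close> and \<open>n\<close> are coprime, \<open>z\<close> descends
  through the whole series and is trivial.
\<close>

lemma nilpotent_coprime_commute:
  fixes m n :: nat
  assumes nil: "nilpotent_group G" and x: "x \<in> carrier G" and y: "y \<in> carrier G"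
    and mn: "coprime m n" and xm: "x [^] m = \<one>" and yn: "y [^] n = \<one>"
  shows "x \<otimes> y = y \<otimes> x"
proof -
  let ?z = "x \<otimes> y \<otimes> inv x \<otimes> inv y"
  have z: "?z \<in> carrier G" using x y by simp
  have "?z \<in> lower_central_series G i" for i
  proof (induction i)
    case (Suc i)
    interpret N: normal "lower_central_series G (Suc i)" G by (rule lower_central_series_normal)
    have zy: "?z \<otimes> y = x \<otimes> y \<otimes> inv x" using x y by (simp add: m_assoc)
    have "?z [^] n \<in> lower_central_series G (Suc i)"
      using pow_mult_mod_normal_iff[OF N.normal_axioms z y commutator_in_lower_central_series'[OF y Suc.IH], of n]
      by (simp add: zy conj_nat_pow x y yn)
    moreover have "?z [^] m \<in> lower_central_series G (Suc i)"
    proof -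
      let ?w = "y \<otimes> inv x \<otimes> inv y"
      have w: "?w \<in> carrier G" using x y by simp
      have "?w [^] m = \<one>" using x y xm by (simp add: conj_nat_pow nat_pow_inv)
      then have xw: "inv ?w [^] m = \<one>" using w by (simp add: nat_pow_inv)
      have "?z \<otimes> inv ?w = x" using x y by (simp add: inv_mult_group m_assoc inv_mult_cancel_left)
      then show ?thesis
        using pow_mult_mod_normal_iff[OF N.normal_axioms z inv_closed[OF w]
            commutator_in_lower_central_series'[OF inv_closed[OF w] Suc.IH], of m] xm xw
        by simp
    qed
    ultimately show ?case
      using coprime_powers_in_subgroup[OF N.is_subgroup z mn] by simp
  qed (use z in simp)
  then have "?z = \<one>" using nil by (metis nilpotent_group_def singletonD)
  then show ?thesis using x y by (metis mult_commutator l_one m_closed)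
qed

text \<open>
  This is the existence of Hall subgroups in a nilpotent group. The elements of exponent \<open>u\<close> in
  each term of the lower central series form a subgroup, by induction from the last term upwards.
  Let \<open>T\<close> be this subgroup for the next term. It suffices that \<open>x\<close> and \<open>y\<close> commute modulo \<open>T\<close>:
  then \<open>x \<otimes> y\<close> has exponent \<open>u * u\<close>, hence \<open>u\<close>. Their commutator splits as \<open>a \<otimes> b\<close> with
  \<open>a\<close> in \<open>T\<close> and \<open>b\<close> of exponent \<open>v\<close>. Here \<open>b\<close> commutes with \<open>y\<close> because their orders are
  coprime, while \<open>b \<otimes> y\<close> equals a conjugate of \<open>y\<close> modulo \<open>T\<close>; comparing \<open>u\<close>-th powers gives
  \<open>b = \<one>\<close>.
\<close>

lemma nilpotent_power_one_subgroup:
  assumes nil: "nilpotent_group G"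
    and uv: "order G = u * v" "coprime u v"
  shows "subgroup {x \<in> carrier G. x [^] u = \<one>} G"
proof -
  obtain c where c: "lower_central_series G c = {\<one>}"
    using nil by (auto simp: nilpotent_group_def)
  let ?T = "\<lambda>i. {x \<in> lower_central_series G i. x [^] u = \<one>}"
  \<comment> \<open>The order of \<open>x\<close> divides \<open>u * v\<close>, so only the part of an exponent
    shared with \<open>u * v\<close> counts.\<close>
  have exp: "x [^] u = \<one>" if x: "x \<in> carrier G" and "x [^] (u * k) = \<one>" "coprime k v" for x k
  proof -
    have "(x [^] u) [^] k = \<one>" "(x [^] u) [^] v = \<one>"
      using x that pow_order_eq_1[OF x] uv(1) by (simp_all add: nat_pow_pow)
    then have "x [^] u \<in> {\<one>}"
      using coprime_powers_in_subgroup[OF triv_subgroup _ that(3)] x by simp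
    then show ?thesis by simp
  qed
  have "subgroup (?T (c - i)) G" for i
  proof (induction i)
    case 0
    have "?T c = {\<one>}" unfolding c by auto
    then show ?case using triv_subgroup by (simp only: diff_zero)
  next
    case (Suc i)
    show ?case
    proof (cases "i < c")
      case False
      then show ?thesis using Suc by simp
    next
      case True
      define j where "j = c - Suc i"
      have ci: "c - i = Suc j" using True by (simp add: j_def)
      interpret L: normal "lower_central_series G j" G by (rule lower_central_series_normal)
      interpret M: normal "lower_central_series G (Suc j)" G by (rule lower_central_series_normal)
      have T: "subgroup (?T (Suc j)) G" using Suc by (simp only: ci)
      have Tn: "?T (Suc j) \<lhd> G"
        using T by (rule normal_invI) (auto simp: conj_nat_pow M.mem_carrier M.inv_op_closed2)
      have "subgroup (?T j) G"
      proof (rule subgroupI)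
        fix x y assume "x \<in> ?T j" "y \<in> ?T j"
        then have xL: "x \<in> lower_central_series G j" and yL: "y \<in> lower_central_series G j" 
          and xu: "x [^] u = \<one>" and yu: "y [^] u = \<one>" by auto
        have x: "x \<in> carrier G" and y: "y \<in> carrier G" using xL yL L.mem_carrier by auto
        define z where "z = x \<otimes> y \<otimes> inv x \<otimes> inv y"
        have zM: "z \<in> lower_central_series G (Suc j)"
          unfolding z_def using commutator_in_lower_central_series[OF x yL] .
        have z: "z \<in> carrier G" using x y by (simp add: z_def)
        have "z [^] (u * v) = \<one>" using pow_order_eq_1[OF z] uv(1) by simp
        then obtain r s :: int where rs: "z = z [^] r \<otimes> z [^] s"
          "(z [^] r) [^] u = \<one>" "(z [^] s) [^] v = \<one>"
          using coprime_power_decomposition[OF z uv(2)] by blast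
        let ?a = "z [^] r" and ?b = "z [^] s"
        have ab: "?a \<in> carrier G" "?b \<in> carrier G" using z by auto
        have aT: "?a \<in> ?T (Suc j)"
          using subgroup_int_pow_closed[OF M.is_subgroup zM] rs(2) by blast
        have bM: "?b \<in> lower_central_series G (Suc j)"
          using subgroup_int_pow_closed[OF M.is_subgroup zM] by blast
        \<comment> \<open>b\<close>
        have comm: "?b \<otimes> y = y \<otimes> ?b"
          using nilpotent_coprime_commute[OF nil ab(2) y] uv(2) rs(3) yu coprime_commute by blast
        let ?w = "x \<otimes> y \<otimes> inv x"
        have w: "?w \<in> carrier G" using x y by simp
        have wu: "?w [^] u = \<one>" using x y yu by (simp add: conj_nat_pow)
        have "?a \<otimes> (?b \<otimes> y) = ?w"
        proof -
          have "?a \<otimes> (?b \<otimes> y) = z \<otimes> y" using ab y rs(1) by (metis m_assoc)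
          also have "\<dots> = ?w" using x y by (simp add: z_def m_assoc)
          finally show ?thesis .
        qed
        then have byw: "?b \<otimes> y = inv ?a \<otimes> ?w" using ab y w by (metis inv_solve_left m_closed)
        have ia: "inv ?a \<in> ?T (Suc j)" using T aT by (rule subgroup.m_inv_closed)
        have "(inv ?a \<otimes> ?w) [^] u \<in> ?T (Suc j)"
        proof -
          have "inv ?a \<otimes> ?w \<otimes> inv (inv ?a) \<otimes> inv ?w \<in> ?T (Suc j)"
          proof -
            have "?w \<otimes> inv (inv ?a) \<otimes> inv ?w \<in> ?T (Suc j)"
              using normal.inv_op_closed2[OF Tn w] aT ab by simp
            then show ?thesis using subgroup.m_closed[OF T ia] w ab by (simp add: m_assoc)
          qed
          moreover have "inv ?a [^] u \<in> ?T (Suc j)" "?w [^] u \<in> ?T (Suc j)"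
            using subgroup.one_closed[OF T] wu ab rs(2) by (simp_all add: nat_pow_inv)
          ultimately show ?thesis
            using pow_mult_mod_normal_iff[OF Tn _ w, of "inv ?a" u] ab by blast
        qed
        then have "?b [^] u \<in> ?T (Suc j)"
          using byw pow_mult_distrib[OF comm ab(2) y, of u] yu ab by simp
        then have "?b [^] (u * u) = \<one>" using ab by (simp add: nat_pow_pow)
        then have "?b [^] u = \<one>" using exp[OF ab(2)] uv(2) by blast
        then have "?b \<in> {\<one>}"
          using coprime_powers_in_subgroup[OF triv_subgroup ab(2) uv(2)] rs(3) by simp
        then have zT: "z \<in> ?T (Suc j)" using rs(1) aT ab by simp
        have "(x \<otimes> y) [^] u \<in> ?T (Suc j)"
          using pow_mult_mod_normal_iff[OF Tn x y, of u] zT xu yu subgroup.one_closed[OF T]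
          unfolding z_def by simp
        then have "(x \<otimes> y) [^] (u * u) = \<one>" using x y by (simp add: nat_pow_pow)
        then have "(x \<otimes> y) [^] u = \<one>" using exp uv(2) x y by blast
        then show "x \<otimes> y \<in> ?T j" using L.m_closed[OF xL yL] by simp
      next
        show "?T j \<subseteq> carrier G" using L.subset by blast
        have "\<one> \<in> ?T j" using L.one_closed by simp
        then show "?T j \<noteq> {}" by blast
        show "inv x \<in> ?T j" if "x \<in> ?T j" for x
          using that L.m_inv_closed by (simp add: nat_pow_inv L.mem_carrier)
      qed
      then show ?thesis by (simp only: j_def)
    qed
  qed
  from this[of c] show ?thesis by (simp only: diff_self_eq_0 lower_central_series.simps(1))
qed

end

section \<open>The lambda action and ideals of skew braces\<close>

context skew_brace
begin

sublocale add: group "add_monoid B"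
  rewrites "carrier (add_monoid B) = carrier B"
    and "monoid.mult (add_monoid B) = ring.add B"
    and "one (add_monoid B) = \<zero>"
    and "m_inv (add_monoid B) = a_inv B"
  by (rule add_group) (auto simp: m_inv_def a_inv_def)

sublocale mult: group B
  by (rule mult_group)

abbreviation lam :: "'a \<Rightarrow> 'a \<Rightarrow> 'a" where
  "lam \<equiv> brace_lambda B"

lemma one_eq_zero: "\<one> = \<zero>"
proof -
  have "\<one> \<otimes> (\<one> \<oplus> \<one>) = (\<one> \<otimes> \<one>) \<ominus> \<one> \<oplus> (\<one> \<otimes> \<one>)" by (rule compat) auto
  then have "\<one> \<oplus> \<one> = \<one>" by (simp add: a_minus_def)
  then show ?thesis by (simp add: add.r_cancel_one)
qed

lemma lam_closed [simp]: "a \<in> carrier B \<Longrightarrow> b \<in> carrier B \<Longrightarrow> lam a b \<in> carrier B"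
  by (simp add: brace_lambda_def)

lemma mult_eq_add_lam: "a \<in> carrier B \<Longrightarrow> b \<in> carrier B \<Longrightarrow> a \<otimes> b = a \<oplus> lam a b"
  by (simp add: brace_lambda_def add.inv_mult_cancel_left)

lemma lam_add:
  "a \<in> carrier B \<Longrightarrow> b \<in> carrier B \<Longrightarrow> c \<in> carrier B \<Longrightarrow> lam a (b \<oplus> c) = lam a b \<oplus> lam a c"
  by (simp add: brace_lambda_def compat a_minus_def add.m_assoc)

lemma lam_group_hom:
  assumes "a \<in> carrier B"
  shows "group_hom (add_monoid B) (add_monoid B) (lam a)"
  using assms add_group
  by (auto simp: group_hom_def group_hom_axioms_def hom_def lam_add)

lemma lam_zero: "a \<in> carrier B \<Longrightarrow> lam a \<zero> = \<zero>"
  using group_hom.hom_one[OF lam_group_hom] by simp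

lemma lam_multiple:
  assumes "a \<in> carrier B" "b \<in> carrier B"
  shows "lam a (b [^]\<^bsub>add_monoid B\<^esub> (n::nat)) = lam a b [^]\<^bsub>add_monoid B\<^esub> n"
  using group_hom.hom_nat_pow[OF lam_group_hom, of a b n] assms by simp

lemma lam_mult:
  assumes a: "a \<in> carrier B" and b: "b \<in> carrier B" and c: "c \<in> carrier B"
  shows "lam (a \<otimes> b) c = lam a (lam b c)"
proof -
  have "a \<oplus> lam a (b \<oplus> lam b c) = a \<otimes> (b \<otimes> c)"
    using assms by (simp add: mult_eq_add_lam)
  also have "\<dots> = a \<otimes> b \<oplus> lam (a \<otimes> b) c"
    using assms by (simp add: mult.m_assoc[symmetric] mult_eq_add_lam[of "a \<otimes> b" c])
  also have "\<dots> = a \<oplus> (lam a b \<oplus> lam (a \<otimes> b) c)"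
    using assms mult_eq_add_lam[of a b] by (simp add: add.m_assoc)
  finally show ?thesis using assms by (simp add: lam_add)
qed

lemma lam_one: "a \<in> carrier B \<Longrightarrow> lam \<one> a = a"
  by (simp add: brace_lambda_def one_eq_zero[symmetric]) (simp add: one_eq_zero)

lemma star_eq: "brace_star B a b = lam a b \<oplus> \<ominus> b"
  by (simp add: brace_star_def a_minus_def)

lemma star_closed [simp]: "a \<in> carrier B \<Longrightarrow> b \<in> carrier B \<Longrightarrow> brace_star B a b \<in> carrier B"
  by (simp add: star_eq)

lemma lam_eq_star: "a \<in> carrier B \<Longrightarrow> b \<in> carrier B \<Longrightarrow> lam a b = brace_star B a b \<oplus> b"
  by (simp add: star_eq add.m_assoc)

text \<open>
  Left ideals are multiplicative subgroups, since \<open>a \<otimes> b = a \<oplus> lam a b\<close>; in particular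
  the inverse of \<open>a\<close> is the negative of \<open>lam (inv a) a\<close>.
\<close>

lemma mult_subgroup_if_lam_invariant:
  assumes I: "subgroup I (add_monoid B)" and lam: "\<And>a x. a \<in> carrier B \<Longrightarrow> x \<in> I \<Longrightarrow> lam a x \<in> I"
  shows "subgroup I B"
proof (rule mult.subgroupI)
  have sub: "I \<subseteq> carrier B" using subgroup.subset[OF I] by simp
  then show "I \<subseteq> carrier B" .
  show "I \<noteq> {}" using subgroup.one_closed[OF I] by auto
  show "a \<otimes> b \<in> I" if "a \<in> I" "b \<in> I" for a b
    using subgroup.m_closed[OF I that(1) lam[OF _ that(2)]] that sub mult_eq_add_lam[of a b]
    by (simp add: subset_iff)
  show "inv a \<in> I" if "a \<in> I" for a
  proof -
    have a: "a \<in> carrier B" using that sub by blast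
    have "inv a \<oplus> lam (inv a) a = \<zero>"
      using a mult_eq_add_lam[of "inv a" a] by (simp add: one_eq_zero)
    then have "inv a = \<ominus> lam (inv a) a" using a add.inv_equality[of "inv a" "lam (inv a) a"] by simp
    then show ?thesis
      using subgroup.m_inv_closed[OF I lam[OF mult.inv_closed[OF a] that]] by (simp only: a_inv_def)
  qed
qed

text \<open>
  This criterion replaces multiplicative normality by \<open>I * X \<subseteq> I\<close>, which can be checked in the
  additive group. Conjugating \<open>x\<close> by \<open>a\<close> in the multiplicative group gives
  \<open>a \<oplus> lam a (x \<oplus> t) \<oplus> \<ominus> a\<close> with \<open>t = x * inv a\<close>, an additive conjugate of an element
  of \<open>I\<close>.
\<close>

lemma brace_idealI:
  assumes I: "I \<lhd> add_monoid B" and lam: "\<And>a x. a \<in> carrier B \<Longrightarrow> x \<in> I \<Longrightarrow> lam a x \<in> I"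
    and star: "\<And>a x. a \<in> I \<Longrightarrow> x \<in> carrier B \<Longrightarrow> brace_star B a x \<in> I"
  shows "brace_ideal I B"
proof -
  interpret I: normal I "add_monoid B" by fact
  have sub: "x \<in> carrier B" if "x \<in> I" for x using I.mem_carrier[OF that] by simp
  have "I \<lhd> B"
  proof (rule mult.normal_invI)
    show "subgroup I B" using I.is_subgroup lam by (rule mult_subgroup_if_lam_invariant)
    fix a x assume a: "a \<in> carrier B" and x: "x \<in> I"
    let ?c = "inv a" and ?t = "brace_star B x (inv a)"
    have xB: "x \<in> carrier B" and t: "?t \<in> I" and tB: "?t \<in> carrier B"
      using x a sub star by auto
    have "a \<oplus> lam a ?c = \<zero>" using a mult_eq_add_lam[of a ?c] by (simp add: one_eq_zero)
    then have c: "lam a ?c = \<ominus> a" using a add.inv_equality[of "lam a ?c" a]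
      by (metis add.inv_comm add.inv_equality lam_closed mult.inv_closed)
    have "a \<otimes> x \<otimes> ?c = a \<otimes> (x \<oplus> (?t \<oplus> ?c))"
      using a xB by (simp add: mult.m_assoc mult_eq_add_lam[of x] lam_eq_star[of x])
    also have "\<dots> = a \<oplus> lam a (x \<oplus> ?t \<oplus> ?c)"
      using a xB tB by (simp add: mult_eq_add_lam[of a] add.m_assoc)
    also have "\<dots> = a \<oplus> lam a (x \<oplus> ?t) \<oplus> \<ominus> a"
      using a xB tB c by (simp add: lam_add add.m_assoc)
    finally have "a \<otimes> x \<otimes> ?c = a \<oplus> lam a (x \<oplus> ?t) \<oplus> \<ominus> a" .
    moreover have "lam a (x \<oplus> ?t) \<in> I" using I.m_closed[OF x t] a lam by simp
    ultimately show "a \<otimes> x \<otimes> ?c \<in> I"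
      using I.inv_op_closed2[of a] a by (simp add: a_inv_def)
  qed
  then show ?thesis using I lam I.is_subgroup by (auto simp: brace_ideal_def)
qed

text \<open>
  The converse of the criterion: rewriting \<open>l \<otimes> x\<close> as \<open>x \<otimes> m\<close> with \<open>m\<close> conjugate to \<open>l\<close>
  and passing to additive notation shows that \<open>l * x\<close> is \<open>\<ominus> l\<close> plus an additive conjugate of
  \<open>lam x m\<close>.
\<close>

lemma ideal_star_right:
  assumes I: "brace_ideal I B" and l: "l \<in> I" and x: "x \<in> carrier B"
  shows "brace_star B l x \<in> I"
proof -
  interpret A: normal I "add_monoid B" using I by (simp add: brace_ideal_def)
  interpret M: normal I B using I by (simp add: brace_ideal_def)
  have lB: "l \<in> carrier B" using l by (rule M.mem_carrier)
  let ?m = "inv x \<otimes> l \<otimes> x"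
  have m: "?m \<in> I" using M.inv_op_closed1[OF x l] .
  have mB: "?m \<in> carrier B" using lB x by simp
  let ?r = "lam x ?m"
  have r: "?r \<in> I" using m x I by (auto simp: brace_ideal_def)
  have rB: "?r \<in> carrier B" using mB x by simp
  have "l \<otimes> x = x \<otimes> ?m" using lB x by (simp add: mult.m_assoc mult.inv_mult_cancel_left)
  then have "l \<oplus> lam l x = x \<oplus> ?r" using lB x mB by (simp add: mult_eq_add_lam)
  then have "lam l x = \<ominus> l \<oplus> (x \<oplus> ?r)" using lB x mB
    by (metis add.inv_mult_cancel_left(1) lam_closed)
  then have "brace_star B l x = \<ominus> l \<oplus> (x \<oplus> ?r \<oplus> \<ominus> x)"
    using lB x rB by (simp add: star_eq add.m_assoc)
  moreover have "x \<oplus> ?r \<oplus> \<ominus> x \<in> I" using A.inv_op_closed2[OF _ r, of x] x by (simp add: a_inv_def)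
  moreover have "\<ominus> l \<in> I" using A.m_inv_closed[OF l] by (simp add: a_inv_def)
  ultimately show ?thesis using A.m_closed by simp
qed

lemma brace_ideal_carrier: "brace_ideal (carrier B) B"
  using add.normal_invI[OF add.subgroup_self] by (intro brace_idealI) auto

lemma brace_ideal_Inter:
  assumes ne: "\<I> \<noteq> {}" and id: "\<And>I. I \<in> \<I> \<Longrightarrow> brace_ideal I B"
  shows "brace_ideal (\<Inter>\<I>) B"
proof (rule brace_idealI)
  show "\<Inter>\<I> \<lhd> add_monoid B"
  proof (rule group.normal_invI[OF add_group])
    show "subgroup (\<Inter>\<I>) (add_monoid B)"
      using group.subgroups_Inter[OF add_group _ ne] id by (simp add: brace_ideal_def)
  qed (use id group.normal_invE(2)[OF add_group] in \<open>auto simp: brace_ideal_def\<close>)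
next
  show "lam a x \<in> \<Inter>\<I>" if "a \<in> carrier B" "x \<in> \<Inter>\<I>" for a x
    using that id by (auto simp: brace_ideal_def image_subset_iff)
  show "brace_star B a x \<in> \<Inter>\<I>" if "a \<in> \<Inter>\<I>" "x \<in> carrier B" for a x
    using that id ideal_star_right by blast
qed

section \<open>The left series and its limit\<close>

lemma set_star_subgroup:
  assumes "S \<subseteq> carrier B" "T \<subseteq> carrier B"
  shows "subgroup (set_star B S T) (add_monoid B)"
  unfolding set_star_def using assms by (intro add.generate_is_subgroup) (auto simp: subset_iff)

lemma left_series_1: "left_series B (Suc 0) = carrier B"
  by (simp add: left_series_def)

lemma left_series_Suc:
  "left_series B (Suc (Suc n)) = set_star B (carrier B) (left_series B (Suc n))"
  by (simp add: left_series_def)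

lemma left_series_subgroup: "subgroup (left_series B (Suc n)) (add_monoid B)"
proof (induction n)
  case 0
  show ?case using add.subgroup_self by (simp add: left_series_1)
next
  case (Suc n)
  then show ?case unfolding left_series_Suc
    using subgroup.subset[OF Suc] by (intro set_star_subgroup) auto
qed

lemma left_series_subset: "left_series B (Suc n) \<subseteq> carrier B"
  using subgroup.subset[OF left_series_subgroup] by simp

lemma star_in_left_series:
  assumes "a \<in> carrier B" "x \<in> left_series B (Suc n)"
  shows "brace_star B a x \<in> left_series B (Suc (Suc n))"
  unfolding left_series_Suc set_star_def using assms by (intro generate.incl) auto

lemma left_series_step: "left_series B (Suc (Suc n)) \<subseteq> left_series B (Suc n)"
proof (induction n)
  case 0
  show ?case using left_series_subset by (simp add: left_series_1)
next
  case (Suc n)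
  have "(\<Union>s\<in>carrier B. \<Union>t\<in>left_series B (Suc (Suc n)). {brace_star B s t})
      \<subseteq> left_series B (Suc (Suc n))"
    using star_in_left_series Suc by blast
  then show ?case
    unfolding left_series_Suc[of "Suc n"] set_star_def
    by (intro add.generate_subgroup_incl left_series_subgroup)
qed

lemma left_series_antimono: "i \<le> j \<Longrightarrow> left_series B (Suc j) \<subseteq> left_series B (Suc i)"
  by (rule lift_Suc_antimono_le[of "\<lambda>n. left_series B (Suc n)"]) (rule left_series_step)

lemma L_infinity_Suc: "L_infinity B = (\<Inter>n. left_series B (Suc n))"
proof -
  have "{1..} = range Suc" by (auto simp: image_iff) (metis Suc_le_D One_nat_def)
  then show ?thesis by (simp add: L_infinity_def)
qed

lemma L_infinity_subgroup: "subgroup (L_infinity B) (add_monoid B)"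
  unfolding L_infinity_Suc by (rule add.subgroups_Inter) (auto simp: left_series_subgroup)

lemma L_infinity_lam:
  assumes a: "a \<in> carrier B" and x: "x \<in> L_infinity B"
  shows "lam a x \<in> L_infinity B"
proof -
  have xB: "x \<in> carrier B" using x left_series_subset by (auto simp: L_infinity_Suc)
  have "brace_star B a x \<in> left_series B (Suc n)" for n
    using star_in_left_series[OF a] left_series_step[of n] x unfolding L_infinity_Suc by blast
  then have "brace_star B a x \<oplus> x \<in> left_series B (Suc n)" for n
    using subgroup.m_closed[OF left_series_subgroup[of n]] x unfolding L_infinity_Suc by force
  then show ?thesis using lam_eq_star[OF a xB] unfolding L_infinity_Suc by simp
qed

lemma L_infinity_attained:
  assumes "finite (carrier B)"
  obtains n where "L_infinity B = left_series B (Suc n)"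
proof -
  let ?S = "\<lambda>n. left_series B (Suc n)"
  obtain n where n: "\<And>k. card (?S n) \<le> card (?S k)"
    using ex_has_least_nat[of "\<lambda>_. True" 0 "\<lambda>n. card (?S n)"] by auto
  have "?S n \<subseteq> ?S k" for k
  proof (cases "k \<le> n")
    case True
    then show ?thesis by (rule left_series_antimono)
  next
    case False
    then have "?S k \<subseteq> ?S n" by (intro left_series_antimono) simp
    moreover have "finite (?S n)" using assms left_series_subset by (rule finite_subset[rotated])
    ultimately have "?S k = ?S n" using n[of k] by (intro card_seteq) auto
    then show ?thesis by simp
  qed
  then have "L_infinity B = ?S n" unfolding L_infinity_Suc by blast
  then show ?thesis by (rule that)
qed

section \<open>The left-nilpotent residual\<close>

lemma coset_group_hom_Quot:
  assumes I: "brace_ideal I B"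
  shows "group_hom (add_monoid B) (add_monoid (B Quot I)) ((+>) I)"
proof -
  interpret N: normal I "add_monoid B" using I by (simp add: brace_ideal_def)
  have Q: "add_monoid (B Quot I) = add_monoid B Mod I"
    by (simp add: FactRing_def FactGroup_def A_RCOSETS_def set_add_def)
  show ?thesis
    using N.r_coset_hom_Mod N.factorgroup_is_group add_group unfolding Q
    by (simp add: group_hom_def group_hom_axioms_def a_r_coset_def)
qed

lemma brace_star_Quot:
  assumes I: "brace_ideal I B" and a: "a \<in> carrier B" and b: "b \<in> carrier B"
  shows "brace_star (B Quot I) (I +> a) (I +> b) = I +> brace_star B a b"
proof -
  have "\<ominus>\<^bsub>B Quot I\<^esub> (I +> x) = I +> (\<ominus> x)" if "x \<in> carrier B" for x
    using group_hom.hom_inv[OF coset_group_hom_Quot[OF I], of x] that by (simp add: a_inv_def)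
  then show ?thesis
    using a b by (simp add: brace_star_def brace_lambda_def a_minus_def brace_Quot_ops[OF I])
qed

text \<open>
  The left series is preserved by the projection to a quotient, so an ideal has left nilpotent
  quotient exactly if it contains a term of the left series.
\<close>

lemma left_series_Quot:
  assumes I: "brace_ideal I B"
  shows "left_series (B Quot I) (Suc n) = (+>) I ` left_series B (Suc n)"
proof (induction n)
  case 0
  show ?case by (auto simp: left_series_def FactRing_def A_RCOSETS_def RCOSETS_def a_r_coset_def)
next
  case (Suc n)
  let ?Q = "B Quot I"
  interpret h: group_hom "add_monoid B" "add_monoid ?Q" "(+>) I"
    by (rule coset_group_hom_Quot[OF I])
  let ?U = "\<Union>s\<in>carrier B. \<Union>t\<in>left_series B (Suc n). {brace_star B s t}"
  have U: "?U \<subseteq> carrier B" using left_series_subset by (auto simp: subset_iff)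
  have car: "carrier ?Q = (+>) I ` carrier B"
    by (auto simp: FactRing_def A_RCOSETS_def RCOSETS_def a_r_coset_def)
  have star: "brace_star ?Q (I +> s) (I +> t) = I +> brace_star B s t"
    if "s \<in> carrier B" "t \<in> left_series B (Suc n)" for s t
    using that left_series_subset by (intro brace_star_Quot[OF I]) auto
  have "left_series ?Q (Suc (Suc n)) = set_star ?Q (carrier ?Q) (left_series ?Q (Suc n))"
    by (simp add: left_series_def)
  also have "\<dots> = generate (add_monoid ?Q) ((+>) I ` ?U)"
    unfolding set_star_def car Suc by (simp add: image_UN star)
  also have "\<dots> = (+>) I ` generate (add_monoid B) ?U"
    using h.generate_img U by simp
  also have "\<dots> = (+>) I ` left_series B (Suc (Suc n))"
    by (simp add: left_series_Suc set_star_def)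
  finally show ?case .
qed

lemma left_nilpotent_Quot_iff:
  assumes I: "brace_ideal I B"
  shows "left_nilpotent (B Quot I) \<longleftrightarrow> (\<exists>n. left_series B (Suc n) \<subseteq> I)"
proof -
  have sub: "subgroup I (add_monoid B)" using I by (simp add: brace_ideal_def)
  have coset: "I +> x = I \<longleftrightarrow> x \<in> I" if "x \<in> carrier B" for x
    using that add.coset_join1[OF _ _ sub] add.coset_join2[OF _ sub] by (auto simp: a_r_coset_def)
  have z: "\<zero>\<^bsub>B Quot I\<^esub> = I" by (simp add: FactRing_def)
  have "left_series (B Quot I) (Suc n) = {I} \<longleftrightarrow> left_series B (Suc n) \<subseteq> I" for n
  proof -
    have "left_series B (Suc n) \<noteq> {}" using subgroup.one_closed[OF left_series_subgroup[of n]] by auto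
    then show ?thesis unfolding left_series_Quot[OF I] using coset left_series_subset[of n] by auto
  qed
  moreover have "left_nilpotent (B Quot I) \<longleftrightarrow> (\<exists>n. left_series (B Quot I) (Suc n) = {I})"
  proof -
    have "(\<exists>n\<ge>1. P n) \<longleftrightarrow> (\<exists>n. P (Suc n))" for P :: "nat \<Rightarrow> bool"
      by (metis One_nat_def Suc_le_D Suc_le_mono le0)
    then show ?thesis unfolding left_nilpotent_def z .
  qed
  ultimately show ?thesis by simp
qed

lemma left_nilpotent_residual_ideal: "brace_ideal (left_nilpotent_residual B) B"
proof -
  have "left_nilpotent (B Quot carrier B)"
    using left_nilpotent_Quot_iff[OF brace_ideal_carrier] left_series_subset by blast
  then show ?thesis unfolding left_nilpotent_residual_def
    using brace_ideal_carrier by (intro brace_ideal_Inter) auto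
qed

lemma L_infinity_subset_residual: "L_infinity B \<subseteq> left_nilpotent_residual B"
proof -
  have "L_infinity B \<subseteq> I" if I: "brace_ideal I B" "left_nilpotent (B Quot I)" for I
    using that left_nilpotent_Quot_iff[OF I(1)] unfolding L_infinity_Suc by blast
  then show ?thesis unfolding left_nilpotent_residual_def by blast
qed

lemma residual_eq_L_infinity:
  assumes "finite (carrier B)" and I: "brace_ideal (L_infinity B) B"
  shows "left_nilpotent_residual B = L_infinity B"
proof -
  have "left_nilpotent (B Quot L_infinity B)"
    using L_infinity_attained[OF assms(1)] left_nilpotent_Quot_iff[OF I] by (metis order_refl)
  then show ?thesis using I L_infinity_subset_residual by (auto simp: left_nilpotent_residual_def)
qed

section \<open>Coprime action along the left series\<close>

text \<open>
  The orbit of \<open>x\<close> under \<open>lam l\<close> is an arithmetic progression as soon as the difference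
  \<open>lam l x \<ominus> x\<close> is fixed by \<open>lam l\<close>.
\<close>

lemma lam_power_translation:
  assumes l: "l \<in> carrier B" and x: "x \<in> carrier B" and y: "y \<in> carrier B"
    and lx: "lam l x = y \<oplus> x" and ly: "lam l y = y"
  shows "lam (l [^] n) x = y [^]\<^bsub>add_monoid B\<^esub> (n::nat) \<oplus> x"
proof (induction n)
  case 0
  show ?case by (simp only: mult.nat_pow_0 add.nat_pow_0 lam_one x add.l_one)
next
  case (Suc n)
  have "lam (l [^] Suc n) x = lam l (lam (l [^] n) x)"
    by (simp only: mult.nat_pow_Suc2 lam_mult mult.nat_pow_closed l x)
  also have "\<dots> = y [^]\<^bsub>add_monoid B\<^esub> n \<oplus> (y \<oplus> x)"
    using l x y by (simp add: Suc lam_add lam_multiple lx ly)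
  finally show ?case using x y by (simp add: add.m_assoc)
qed

text \<open>
  Coprime action on a group with an invariant series: on \<open>K\<close> the left series reaches zero, and
  \<open>lam l\<close> acts trivially on its successive steps. Going up the series, the difference
  \<open>y = lam l x \<ominus> x\<close> lies one step lower and so is fixed; since the \<open>m\<close>-th power of \<open>lam l\<close> is
  the identity, the \<open>m\<close>-fold multiple of \<open>y\<close> vanishes, and so does its \<open>v\<close>-fold multiple.
\<close>

lemma coprime_action_trivial:
  assumes K: "subgroup K (add_monoid B)" and lam: "\<And>a x. a \<in> carrier B \<Longrightarrow> x \<in> K \<Longrightarrow> lam a x \<in> K"
    and exp: "\<And>x. x \<in> K \<Longrightarrow> x [^]\<^bsub>add_monoid B\<^esub> (v::nat) = \<zero>"
    and n: "left_series B (Suc n) \<inter> K \<subseteq> {\<zero>}"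
    and l: "l \<in> carrier B" and lm: "l [^] (m::nat) = \<one>" and mv: "coprime m v"
    and x: "x \<in> K"
  shows "lam l x = x"
proof -
  have KB: "z \<in> carrier B" if "z \<in> K" for z using subgroup.mem_carrier[OF K that] by simp
  have "\<forall>x \<in> left_series B (Suc (n - i)) \<inter> K. lam l x = x" for i
  proof (induction i)
    case 0
    show ?case using n l lam_zero by auto
  next
    case (Suc i)
    show ?case
    proof (cases "i < n")
      case False
      then show ?thesis using Suc by simp
    next
      case True
      then have j: "n - i = Suc (n - Suc i)" by simp
      show ?thesis
      proof
        fix x assume x: "x \<in> left_series B (Suc (n - Suc i)) \<inter> K"
        let ?y = "brace_star B l x"
        have xB: "x \<in> carrier B" using x KB by blast
        have yB: "?y \<in> carrier B" using xB l by simp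
        have "\<ominus> x \<in> K" using subgroup.m_inv_closed[OF K, of x] x by (simp add: a_inv_def)
        then have yK: "?y \<in> K" using lam[OF l] x subgroup.m_closed[OF K] by (simp add: star_eq)
        moreover have "?y \<in> left_series B (Suc (n - i))" unfolding j using x by (intro star_in_left_series l) auto
        ultimately have ly: "lam l ?y = ?y" using Suc by blast
        have "?y [^]\<^bsub>add_monoid B\<^esub> m \<oplus> x = x"
          using lam_power_translation[OF l xB yB lam_eq_star[OF l xB] ly, of m] lm xB by (simp add: lam_one)
        then have "?y [^]\<^bsub>add_monoid B\<^esub> m = \<zero>"
          using xB yB by (simp add: add.l_cancel_one)
        then have "?y \<in> {\<zero>}"
          using add.coprime_powers_in_subgroup[OF add.triv_subgroup yB mv] exp[OF yK] by simp
        then show "lam l x = x" using lam_eq_star[OF l xB] xB by simp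
      qed
    qed
  qed
  from this[of n] show ?thesis using x KB by (simp add: left_series_1)
qed

text \<open>
  Here \<open>H\<close> and \<open>K\<close> are the complementary Hall subgroups of the additive group, \<open>H\<close> for the
  primes dividing the order of \<open>L\<close>.
\<close>

lemma L_infinity_ideal_if_coprime_index:
  assumes fin: "finite (carrier B)" and nilt: "nilpotent_type B"
    and cop: "coprime (card (L_infinity B))
      (subgroup_index (add_monoid B) (left_nilpotent_residual B) (L_infinity B))"
  shows "brace_ideal (L_infinity B) B"
proof -
  let ?L = "L_infinity B" and ?R = "left_nilpotent_residual B" and ?A = "add_monoid B"
  have nil: "nilpotent_group ?A" using nilt by (simp add: nilpotent_type_def)
  have Rid: "brace_ideal ?R B" by (rule left_nilpotent_residual_ideal)
  interpret R: normal ?R ?A using Rid by (simp add: brace_ideal_def)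
  interpret L: subgroup ?L ?A by (rule L_infinity_subgroup)
  have LB: "?L \<subseteq> carrier B" and RB: "?R \<subseteq> carrier B" using L.subset R.subset by auto
  have LR: "?L \<subseteq> ?R" by (rule L_infinity_subset_residual)
  define m where "m = card ?L"
  define k where "k = subgroup_index ?A ?R ?L"
  define N where "N = card (carrier B)"
  have Rcard: "card ?R = k * m"
    using add.lagrange_subgroup[OF L.subgroup_axioms R.is_subgroup LR] by (simp add: k_def m_def)
  have ordA: "order ?A = N" by (simp add: order_def N_def)
  have "m dvd N"
    using add.lagrange[OF L.subgroup_axioms] ordA unfolding m_def by (metis dvd_triv_right)
  moreover have "N > 0" using fin add.one_closed unfolding N_def by (auto simp: card_gt_0_iff)
  ultimately obtain u v where N: "N = u * v" and uv: "coprime u v" and mu: "m dvd u"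
    and um: "\<And>p. Factorial_Ring.prime p \<Longrightarrow> p dvd u \<Longrightarrow> p dvd m"
    using coprime_split_nat by metis
  have mv: "coprime m v" using uv mu by (metis coprime_divisors dvd_refl)
  define H where "H = {x \<in> carrier B. x [^]\<^bsub>?A\<^esub> u = \<zero>}"
  define K where "K = {x \<in> carrier B. x [^]\<^bsub>?A\<^esub> v = \<zero>}"
  have Hsub: "subgroup H ?A" unfolding H_def
    using add.nilpotent_power_one_subgroup[OF nil, of u v] ordA N uv by simp
  have Ksub: "subgroup K ?A" unfolding K_def
    using add.nilpotent_power_one_subgroup[OF nil, of v u] ordA N uv
    by (simp add: mult.commute coprime_commute)
  have Hlam: "lam a x \<in> H" if "a \<in> carrier B" "x \<in> H" for a x
    using that by (simp add: H_def lam_zero flip: lam_multiple)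
  have Klam: "lam a x \<in> K" if "a \<in> carrier B" "x \<in> K" for a x
    using that by (simp add: K_def lam_zero flip: lam_multiple)
  have Hnormal: "H \<lhd> ?A"
    using Hsub by (rule group.normal_invI[OF add_group]) (simp add: H_def a_inv_def[symmetric] add.conj_nat_pow)
  have Lm: "x [^]\<^bsub>?A\<^esub> m = \<zero>" if "x \<in> ?L" for x
    using add.subgroup_pow_card[OF L.subgroup_axioms that] by (simp add: m_def)
  have LH: "?L \<subseteq> H"
  proof
    fix x assume x: "x \<in> ?L"
    obtain w where "u = m * w" using mu by auto
    moreover have "x \<in> carrier B" using x LB by blast
    ultimately show "x \<in> H" using Lm[OF x] by (simp add: H_def flip: add.nat_pow_pow)
  qed
  \<comment> \<open>The index of \<open>L\<close> in \<open>R\<close> is prime to the order of \<open>L\<close>, so \<open>R \<inter> H\<close> leaves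
    no room above \<open>L\<close>.\<close>
  have RH: "?R \<inter> H = ?L"
  proof -
    let ?P = "?R \<inter> H"
    have Psub: "subgroup ?P ?A" using add.subgroups_Inter_pair[OF R.is_subgroup Hsub] .
    have Pfin: "finite ?P" using fin by (rule finite_subset[rotated]) (use RB in blast)
    have "card ?P dvd card ?R"
      by (simp flip: add.lagrange_subgroup[OF Psub R.is_subgroup Int_lower1])
    moreover have "coprime (card ?P) k"
    proof (rule coprime_natI)
      fix p assume p: "Factorial_Ring.prime p" "p dvd card ?P"
      have "p dvd u"
        by (rule add.prime_dvd_card_imp_dvd_exponent[OF Psub Pfin _ p]) (simp add: H_def)
      then have "p dvd m" using um p(1) by blast
      then show "\<not> p dvd k"
        using cop p(1) coprime_common_divisor[of m k p] unfolding m_def k_def by auto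
    qed
    ultimately have "card ?P dvd m" by (simp add: Rcard coprime_dvd_mult_right_iff)
    moreover have "m > 0" using \<open>m dvd N\<close> \<open>N > 0\<close> by (auto intro: dvd_pos_nat)
    ultimately have "card ?P \<le> card ?L" unfolding m_def by (rule dvd_imp_le)
    then show ?thesis using card_seteq[OF Pfin, of ?L] LH LR by simp
  qed
  have Lnormal: "?L \<lhd> ?A"
    using group.normal_subgroup_intersect[OF add_group R.normal_axioms Hnormal] by (simp add: RH)
  have fixK: "lam l x = x" if l: "l \<in> ?L" and x: "x \<in> K" for l x
  proof -
    obtain n where n: "?L = left_series B (Suc n)" using L_infinity_attained[OF fin] .
    have "z = \<zero>" if "z \<in> ?L" "z \<in> K" for z
      using add.coprime_powers_in_subgroup[OF add.triv_subgroup _ mv, of z] Lm[OF that(1)] that(2)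
      by (simp add: K_def)
    then have LK: "left_series B (Suc n) \<inter> K \<subseteq> {\<zero>}" using n by blast
    have Lmult: "subgroup ?L B"
      using L.subgroup_axioms L_infinity_lam by (rule mult_subgroup_if_lam_invariant)
    have "l [^] m = \<one>"
      using mult.subgroup_pow_card[OF Lmult l] by (simp add: m_def)
    moreover have "l \<in> carrier B" using l LB by blast
    moreover have "z [^]\<^bsub>?A\<^esub> v = \<zero>" if "z \<in> K" for z using that by (simp add: K_def)
    ultimately show ?thesis using coprime_action_trivial[OF Ksub Klam _ LK _ _ mv x] by blast
  qed
  show ?thesis
  proof (rule brace_idealI[OF Lnormal L_infinity_lam])
    fix l x assume l: "l \<in> ?L" and x: "x \<in> carrier B"
    have lB: "l \<in> carrier B" using l LB by blast
    have "x [^]\<^bsub>?A\<^esub> (u * v) = \<zero>" using add.pow_order_eq_1[OF x] ordA N by simp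
    then obtain r s :: int where rs: "x = x [^]\<^bsub>?A\<^esub> r \<oplus> x [^]\<^bsub>?A\<^esub> s"
      "(x [^]\<^bsub>?A\<^esub> r) [^]\<^bsub>?A\<^esub> u = \<zero>" "(x [^]\<^bsub>?A\<^esub> s) [^]\<^bsub>?A\<^esub> v = \<zero>"
      using add.coprime_power_decomposition[OF x uv] by blast
    define a b where "a = x [^]\<^bsub>?A\<^esub> r" and "b = x [^]\<^bsub>?A\<^esub> s"
    have xab: "x = a \<oplus> b" using rs(1) by (simp add: a_def b_def)
    have aH: "a \<in> H" and bK: "b \<in> K" and ab: "a \<in> carrier B" "b \<in> carrier B"
      using rs(2,3) x by (simp_all add: a_def b_def H_def K_def)
    have "brace_star B l x = brace_star B l a"
      using ab lB fixK[OF l bK] by (simp add: xab star_eq lam_add add.inv_mult_group add.m_assoc add.inv_mult_cancel_left)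
    moreover have "brace_star B l a \<in> ?R"
      using ideal_star_right[OF Rid _ ab(1)] l LR by blast
    moreover have "brace_star B l a \<in> H"
      using Hlam[OF lB aH] subgroup.m_closed[OF Hsub] subgroup.m_inv_closed[OF Hsub aH]
      by (simp add: star_eq a_inv_def)
    ultimately show "brace_star B l x \<in> ?L" using RH by auto
  qed
qed

end

theorem corollary6p15:
  fixes B :: "('a, 'b) ring_scheme"
  assumes "skew_brace B"
    and "finite (carrier B)"
    and "nilpotent_type B"
    and "coprime (card (L_infinity B))
           (subgroup_index (add_monoid B) (left_nilpotent_residual B) (L_infinity B))"
  shows "brace_ideal (L_infinity B) B \<and> left_nilpotent_residual B = L_infinity B"
proof -
  interpret skew_brace B by fact
  have "brace_ideal (L_infinity B) B"
    using assms(2-4) by (rule L_infinity_ideal_if_coprime_index)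
  then show ?thesis using residual_eq_L_infinity[OF assms(2)] by blast
qed

end
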